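(* Let $\mathbb{K}$ be an algebraically closed field of characteristic zero and let $B$ be a commutative $\mathbb{K}$-domain. Let $m,n_1,\dots,n_m$ be positive integers with $m\ge 3$, let $a_1,\dots,a_m\in\mathbb{K}$ be nonzero, and for $1\le i\le m$, $1\le j\le n_i$ let $k_{ij}$ be positive integers and $b_{ij}\in B$. Put $$f_i:=a_i\, b_{i1}^{k_{i1}}\cdots b_{in_i}^{k_{in_i}}\in B,\qquad i=1,\dots,m.$$ Assume that $f_1+\dots+f_m=0$, that the elements $f_1,\dots,f_m$ are pairwise relatively prime in $B$, and that $$\sum_{i=1}^{m}\sum_{j=1}^{n_i}\frac{1}{k_{ij}}\le \frac{1}{m-2}.$$ Then $\mathbb{K}[b_{11},\dots,b_{mn_m}]\subseteq \mathrm{ML}(B)$, where $\mathbb{K}[b_{11},\dots,b_{mn_m}]$ is the $\mathbb{K}$-subalgebra of $B$ generated by all the $b_{ij}$.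
   Context: A derivation on a commutative $\mathbb{K}$-domain $B$ is a $\mathbb{K}$-linear map $D:B\to B$ satisfying the Leibniz rule; it is locally nilpotent if for each $b\in B$ there is a non-negative integer $n$ with $D^n(b)=0$. $\mathrm{LND}(B)$ is the set of locally nilpotent derivations on $B$, and the Makar-Limanov invariant of $B$ is $\mathrm{ML}(B)=\bigcap_{D\in\mathrm{LND}(B)}\mathrm{Ker}\, D$. Elements $b_1,b_2\in B$ are relatively prime in $B$ if $(b_1)\cap(b_2)=(b_1b_2)$ as ideals of $B$.
   Formalization: All f_i are additionally assumed nonzero (so all b_ij are nonzero): literally, 0 is relatively prime to every element, and the claim fails for B = K[x], m = 3, f_1 = 0^4 x^4, f_2 = 1^4, f_3 = -1^4, since x is not in ML(B) = K. *)

theory Defs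
  imports Complex_Main "HOL-Computational_Algebra.Polynomial"
begin

locale comm_algebra = vector_space scale
  for scale :: "'k::field \<Rightarrow> 'b::comm_ring_1 \<Rightarrow> 'b" (infixr \<open>*s\<close> 75) +
  assumes mult_scale_left: "(c *s x) * y = c *s (x * y)"
begin

definition derivation :: "('b \<Rightarrow> 'b) \<Rightarrow> bool"
  where "derivation D \<longleftrightarrow>
    Vector_Spaces.linear scale scale D \<and> (\<forall>x y. D (x * y) = D x * y + x * D y)"

definition locally_nilpotent :: "('b \<Rightarrow> 'b) \<Rightarrow> bool"
  where "locally_nilpotent D \<longleftrightarrow> (\<forall>x. \<exists>n::nat. (D ^^ n) x = 0)"

definition LND :: "('b \<Rightarrow> 'b) set"
  where "LND = {D. derivation D \<and> locally_nilpotent D}"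

definition makar_limanov :: "'b set"
  where "makar_limanov = (\<Inter>D\<in>LND. {x. D x = 0})"

definition subalgebra :: "'b set \<Rightarrow> bool"
  where "subalgebra S \<longleftrightarrow> subspace S \<and> 1 \<in> S \<and> (\<forall>x\<in>S. \<forall>y\<in>S. x * y \<in> S)"

definition generated_subalgebra :: "'b set \<Rightarrow> 'b set"
  where "generated_subalgebra X = subalgebra hull X"

end

definition principal_ideal :: "'b::comm_ring_1 \<Rightarrow> 'b set"
  where "principal_ideal x = {r * x | r. True}"

text \<open>
  For nonzero elements of a domain this implies the library's \<open>coprime\<close> (every common divisor
  is a unit), but not conversely in general. Note that \<open>0\<close> is relatively prime to every element.
\<close>
definition relatively_prime :: "'b::comm_ring_1 \<Rightarrow> 'b \<Rightarrow> bool"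
  where "relatively_prime x y \<longleftrightarrow>
    principal_ideal x \<inter> principal_ideal y = principal_ideal (x * y)"

end

theory Submission
  imports Defs "Jordan_Normal_Form.Determinant"
begin

text \<open>
  Fix a locally nilpotent derivation \<open>D\<close>. The largest \<open>n\<close> with \<open>D\<^sup>n x \<noteq> 0\<close> behaves like the degree
  of a polynomial, and Mason's Wronskian argument can be run inside \<open>B\<close> itself. Let \<open>f\<^sub>0\<close> be one
  of the \<open>f\<^sub>i\<close> of maximal degree, and choose \<open>f\<^sub>1, \<dots>, f\<^sub>r\<close> (\<open>r = s + 1\<close>) among the others, maximal
  with Wronskian \<open>W \<noteq> 0\<close>. Then a constant multiple of \<open>f\<^sub>0\<close> is a combination of \<open>f\<^sub>1, \<dots>, f\<^sub>r\<close> with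
  constant coefficients, so by Cramer's rule a nonzero constant multiple of \<open>W\<close> is divisible by
  \<open>\<Prod>\<^sub>j b\<^sub>i\<^sub>j\<close> with exponents \<open>k\<^sub>i\<^sub>j - s\<close> (truncated at \<open>0\<close>) for each \<open>i = 0, \<dots>, r\<close>, and by relative
  primeness by the product of these. Comparing with \<open>deg W \<le> deg f\<^sub>1 + \<dots> + deg f\<^sub>r - r(r - 1)/2\<close>
  bounds \<open>deg f\<^sub>0\<close> by \<open>s\<close> times the sum of the degrees of the \<open>b\<^sub>i\<^sub>j\<close>, strictly if \<open>s > 0\<close>. Since
  \<open>deg b\<^sub>i\<^sub>j \<le> deg f\<^sub>0 / k\<^sub>i\<^sub>j\<close> and \<open>s \<le> m - 2\<close>, this forces \<open>deg f\<^sub>0 = 0\<close>, hence \<open>D b\<^sub>i\<^sub>j = 0\<close>.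
\<close>

section \<open>Relatively prime elements\<close>

lemma relatively_prime_iff_dvd:
  "relatively_prime x y \<longleftrightarrow> (\<forall>z. x dvd z \<longrightarrow> y dvd z \<longrightarrow> x * y dvd z)"
proof -
  have principal_ideal_iff: "z \<in> principal_ideal x \<longleftrightarrow> x dvd z" for x z :: 'a
    by (auto simp: principal_ideal_def dvd_def mult.commute)
  show ?thesis
    unfolding relatively_prime_def set_eq_iff Int_iff principal_ideal_iff
    by (auto intro: dvd_mult_left dvd_mult_right)
qed

text \<open>With cofactors \<open>s\<close> and \<open>t\<close>, the element
  \<open>z * s * t\<close> is a common multiple of \<open>x\<close> and \<open>y\<close>; the
  nonzero factor \<open>s * t\<close> then cancels from \<open>x * y dvd z * s * t\<close>.\<close>

lemma relatively_prime_dvd: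
  fixes x y :: "'a::idom"
  assumes "relatively_prime x y" "x' dvd x" "y' dvd y" "x \<noteq> 0" "y \<noteq> 0"
  shows "relatively_prime x' y'"
  unfolding relatively_prime_iff_dvd
proof (intro allI impI)
  fix z assume z: "x' dvd z" "y' dvd z"
  obtain s t where st: "x = x' * s" "y = y' * t"
    using assms(2,3) by (meson dvdE)
  have "x dvd z * s * t"
    unfolding st(1) by (rule dvd_mult2) (rule mult_dvd_mono[OF z(1) dvd_refl])
  moreover have "y dvd z * s * t"
    unfolding st(2) using mult_dvd_mono[OF dvd_mult2[OF z(2)] dvd_refl] .
  ultimately have "x * y dvd z * s * t"
    using assms(1) by (simp add: relatively_prime_iff_dvd)
  moreover have "x * y = x' * y' * (s * t)" "z * s * t = z * (s * t)"
    unfolding st by (simp_all only: ac_simps)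
  ultimately have "x' * y' * (s * t) dvd z * (s * t)" by simp
  moreover have "s * t \<noteq> 0" using assms(4,5) st by auto
  ultimately show "x' * y' dvd z" by (metis dvd_mult_cancel_right)
qed

text \<open>Once a common multiple is written as \<open>h = y * (x * w)\<close>, cancelling
  \<open>y\<close> turns \<open>y * z dvd h\<close> into \<open>z dvd x * w\<close>, so the second
  hypothesis applies to \<open>x * w\<close> rather than to \<open>h\<close>.\<close>

lemma relatively_prime_mult_right:
  fixes x y z :: "'a::idom"
  assumes "relatively_prime x y" "relatively_prime x z" "y \<noteq> 0"
  shows "relatively_prime x (y * z)"
  unfolding relatively_prime_iff_dvd
proof (intro allI impI)
  fix h assume h: "x dvd h" "y * z dvd h"
  from h(2) have "y dvd h" by (rule dvd_mult_left)
  with h(1) assms(1) have "x * y dvd h" by (simp add: relatively_prime_iff_dvd)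
  then obtain w where "h = (x * y) * w" ..
  then have w: "h = y * (x * w)" by (simp only: ac_simps)
  have "z dvd x * w" using h(2) assms(3) unfolding w by simp
  moreover have "x dvd x * w" by simp
  ultimately have "x * z dvd x * w" using assms(2) unfolding relatively_prime_iff_dvd by blast
  then have "y * (x * z) dvd h" unfolding w by (rule mult_dvd_mono[OF dvd_refl])
  then show "x * (y * z) dvd h" by (simp only: mult.left_commute)
qed

lemma relatively_prime_prod_right:
  fixes p :: "'i \<Rightarrow> 'a::idom"
  assumes "finite S" "\<And>i. i \<in> S \<Longrightarrow> p i \<noteq> 0" "\<And>i. i \<in> S \<Longrightarrow> relatively_prime x (p i)"
  shows "relatively_prime x (prod p S)"
  using assms
proof (induction S)
  case empty
  then show ?case by (simp add: relatively_prime_iff_dvd)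
next
  case (insert i S)
  then show ?case by (simp add: relatively_prime_mult_right)
qed

lemma prod_dvd_if_pairwise_relatively_prime:
  fixes p :: "'i \<Rightarrow> 'a::idom"
  assumes "finite S" "\<And>i. i \<in> S \<Longrightarrow> p i \<noteq> 0" "\<And>i. i \<in> S \<Longrightarrow> p i dvd z"
    and "\<And>i j. i \<in> S \<Longrightarrow> j \<in> S \<Longrightarrow> i \<noteq> j \<Longrightarrow> relatively_prime (p i) (p j)"
  shows "prod p S dvd z"
  using assms
proof (induction S)
  case (insert i S)
  have "relatively_prime (p i) (prod p S)"
    by (rule relatively_prime_prod_right) (use insert.hyps insert.prems in blast)+
  moreover have "p i dvd z" by (rule insert.prems) simp
  moreover have "prod p S dvd z"
    by (rule insert.IH) (use insert.prems in blast)+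
  ultimately have "p i * prod p S dvd z" by (simp add: relatively_prime_iff_dvd)
  then show ?case using insert.hyps by simp
qed simp

section \<open>The degree function of a locally nilpotent derivation\<close>

text \<open>Scalars enter only as ring elements killed by \<open>D\<close>. What remains of
  characteristic zero is \<open>char_0\<close>, which keeps the binomial coefficient in
  \<open>deg_mult\<close> from vanishing.\<close>

locale locally_nilpotent_derivation =
  fixes D :: "'b::idom \<Rightarrow> 'b"
  assumes D_add: "D (x + y) = D x + D y"
    and D_mult: "D (x * y) = D x * y + x * D y"
    and nilpotent: "\<exists>n. (D ^^ n) x = 0"
    and char_0: "n > 0 \<Longrightarrow> of_nat n \<noteq> (0::'b)"
begin

lemma D_0 [simp]: "D 0 = 0"
  using D_add[of 0 0] by (metis add_0 add_cancel_right_right)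

lemma D_1 [simp]: "D 1 = 0"
  using D_mult[of 1 1] by (metis add_cancel_right_right mult_1 mult_1_right)

lemma D_uminus: "D (- x) = - D x"
  using D_add[of x "- x"] by (simp add: eq_neg_iff_add_eq_0 add.commute)

lemma D_sum: "D (sum g A) = (\<Sum>i\<in>A. D (g i))"
  by (induction A rule: infinite_finite_induct) (auto simp: D_add)

lemma Dn_0 [simp]: "(D ^^ n) 0 = 0"
  by (induction n) auto

lemma Dn_add: "(D ^^ n) (x + y) = (D ^^ n) x + (D ^^ n) y"
  by (induction n) (auto simp: D_add)

lemma Dn_sum: "(D ^^ n) (sum g A) = (\<Sum>i\<in>A. (D ^^ n) (g i))"
  by (induction n) (auto simp: D_sum)

lemma Dn_mult_const: "D c = 0 \<Longrightarrow> (D ^^ n) (c * x) = c * (D ^^ n) x"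
  by (induction n) (auto simp: D_mult)

lemma Dn_eq_0_mono:
  assumes "(D ^^ m) x = 0" "m \<le> n"
  shows "(D ^^ n) x = 0"
proof -
  have "(D ^^ n) x = (D ^^ (n - m)) ((D ^^ m) x)"
    using assms(2) by (simp flip: funpow_add comp_apply[of "D ^^ _" "D ^^ _"])
  then show ?thesis using assms(1) by simp
qed

text \<open>Every other term of the general Leibniz formula differentiates \<open>x\<close> more
  than \<open>a\<close> times or \<open>y\<close> more than \<open>b\<close> times. The induction
  avoids that formula: it splits off one \<open>D\<close> and joins the two halves by Pascal's
  rule.\<close>

lemma Dn_mult_top:
  assumes "(D ^^ Suc a) x = 0" "(D ^^ Suc b) y = 0"
  shows "(D ^^ (a + b)) (x * y) = of_nat ((a + b) choose a) * ((D ^^ a) x * (D ^^ b) y)"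
  using assms
proof (induction "a + b" arbitrary: a b x y)
  case (Suc n)
  show ?case
  proof (cases "a = 0 \<or> b = 0")
    case True
    then show ?thesis
      using Dn_mult_const[of x b y] Dn_mult_const[of y a x] Suc.prems
      by (auto simp: mult.commute)
  next
    case False
    then obtain a' b' where ab: "a = Suc a'" "b = Suc b'"
      by (metis not0_implies_Suc)
    have shift: "(D ^^ k) (D z) = (D ^^ Suc k) z" for k z
      by (simp add: funpow_swap1)
    have "(D ^^ (a' + b)) (D x * y)
        = of_nat ((a' + b) choose a') * ((D ^^ a') (D x) * (D ^^ b) y)"
      using Suc.hyps(2) Suc.prems unfolding ab
      by (intro Suc.hyps(1)) (simp_all add: shift del: funpow.simps)
    moreover have "(D ^^ (a + b')) (x * D y)
        = of_nat ((a + b') choose a) * ((D ^^ a) x * (D ^^ b') (D y))"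
      using Suc.hyps(2) Suc.prems unfolding ab
      by (intro Suc.hyps(1)) (simp_all add: shift del: funpow.simps)
    moreover have "(D ^^ (a + b)) (x * y) = (D ^^ (a' + b)) (D x * y) + (D ^^ (a + b')) (x * D y)"
    proof -
      have eq: "a + b' = a' + b" using ab by simp
      have "(D ^^ (a + b)) (x * y) = (D ^^ (a' + b)) (D (x * y))"
        unfolding shift using ab by simp
      then show ?thesis by (simp only: eq D_mult Dn_add)
    qed
    moreover have "(a + b) choose a = ((a' + b) choose a') + ((a + b') choose a)"
      using ab by simp
    ultimately show ?thesis
      unfolding shift ab by (simp add: distrib_right del: funpow.simps)
  qed
qed simp

text \<open>Here \<open>deg 0 = 0\<close> rather than minus infinity, so \<open>deg_le_iff\<close>
  holds without exception while additivity needs nonzero factors.\<close>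

definition deg :: "'b \<Rightarrow> nat"
  where "deg x = (LEAST n. (D ^^ Suc n) x = 0)"

lemma deg_le_iff: "deg x \<le> n \<longleftrightarrow> (D ^^ Suc n) x = 0"
proof -
  obtain k where "(D ^^ Suc k) x = 0"
    using nilpotent[of x] Dn_eq_0_mono[of _ x "Suc _"] by (meson le_SucI order_refl)
  then have "(D ^^ Suc (deg x)) x = 0"
    unfolding deg_def by (rule LeastI)
  moreover have "deg x \<le> n" if "(D ^^ Suc n) x = 0"
    unfolding deg_def using that by (rule Least_le)
  ultimately show ?thesis using Dn_eq_0_mono[of "Suc (deg x)" x "Suc n"] by auto
qed

lemma Dn_Suc_deg: "(D ^^ Suc (deg x)) x = 0"
  using deg_le_iff order_refl by blast

lemma Dn_deg_nonzero:
  assumes "x \<noteq> 0"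
  shows "(D ^^ deg x) x \<noteq> 0"
proof (cases "deg x")
  case (Suc n)
  then show ?thesis using deg_le_iff[of x n] by simp
qed (use assms in simp)

lemma deg_eqI: "(D ^^ n) x \<noteq> 0 \<Longrightarrow> (D ^^ Suc n) x = 0 \<Longrightarrow> deg x = n"
  by (metis Dn_Suc_deg Dn_eq_0_mono deg_le_iff le_antisym not_less_eq_eq)

lemma deg_eq_0_iff: "deg x = 0 \<longleftrightarrow> D x = 0"
  using deg_le_iff[of x 0] by simp

text \<open>The top derivative of the product is a positive integer times the product of the two top
  derivatives: nonzero in a domain of characteristic zero, and again a constant of
  \<open>D\<close>.\<close>

lemma deg_mult:
  assumes "x \<noteq> 0" "y \<noteq> 0"
  shows "deg (x * y) = deg x + deg y"
proof (rule deg_eqI)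
  have top: "(D ^^ (deg x + deg y)) (x * y)
      = of_nat ((deg x + deg y) choose deg x) * ((D ^^ deg x) x * (D ^^ deg y) y)"
    by (intro Dn_mult_top Dn_Suc_deg)
  show "(D ^^ (deg x + deg y)) (x * y) \<noteq> 0"
    unfolding top using char_0[of "(deg x + deg y) choose deg x"] Dn_deg_nonzero assms by simp
  have "D (of_nat k) = 0" for k
    by (induction k) (auto simp: D_add)
  then show "(D ^^ Suc (deg x + deg y)) (x * y) = 0"
    using top Dn_Suc_deg[of x] Dn_Suc_deg[of y] by (simp add: D_mult)
qed

lemma deg_prod:
  assumes "\<And>i. i \<in> A \<Longrightarrow> g i \<noteq> 0"
  shows "deg (prod g A) = (\<Sum>i\<in>A. deg (g i))"
  using assms
  by (induction A rule: infinite_finite_induct) (auto simp: deg_mult deg_eq_0_iff)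

lemma deg_power: "x \<noteq> 0 \<Longrightarrow> deg (x ^ n) = n * deg x"
  by (induction n) (auto simp: deg_mult deg_eq_0_iff)

lemma deg_dvd:
  assumes "x dvd y" "y \<noteq> 0"
  shows "deg x \<le> deg y"
  using assms by (auto elim!: dvdE simp: deg_mult)

lemma deg_Dn:
  assumes "(D ^^ n) x \<noteq> 0"
  shows "deg ((D ^^ n) x) + n = deg x"
proof -
  have "n \<le> deg x"
    using assms Dn_eq_0_mono[OF Dn_Suc_deg[of x], of n] by (meson not_less_eq_eq)
  moreover have "deg ((D ^^ n) x) = deg x - n"
  proof (rule deg_eqI)
    have comp: "(D ^^ k) ((D ^^ n) x) = (D ^^ (k + n)) x" for k
      by (simp add: funpow_add)
    have "x \<noteq> 0" using assms by auto
    then show "(D ^^ (deg x - n)) ((D ^^ n) x) \<noteq> 0"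
      unfolding comp using \<open>n \<le> deg x\<close> Dn_deg_nonzero by simp
    show "(D ^^ Suc (deg x - n)) ((D ^^ n) x) = 0"
      unfolding comp using \<open>n \<le> deg x\<close> Dn_Suc_deg[of x] by simp
  qed
  ultimately show ?thesis by simp
qed

text \<open>In each summand of the product rule at most one factor is differentiated, which lowers
  its exponent by at most one. Truncated subtraction keeps exponent \<open>0\<close> at
  \<open>0\<close>.\<close>

lemma prod_power_dvd_D:
  assumes "finite J" "(\<Prod>j\<in>J. b j ^ k j) dvd x"
  shows "(\<Prod>j\<in>J. b j ^ (k j - 1)) dvd D x"
proof -
  have power: "b j ^ (k j - 1) dvd b j ^ k j" for j
    by (rule le_imp_power_dvd) simp
  have D_power: "y ^ (l - 1) dvd D (y ^ l)" for y l
  proof (cases l)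
    case (Suc l')
    have "y ^ l dvd D (y ^ Suc l)" for l
    proof (induction l)
      case (Suc l)
      then have "y ^ Suc l dvd y * D (y ^ Suc l)" by (simp add: mult_dvd_mono)
      then show ?case by (subst power_Suc) (auto simp: D_mult intro!: dvd_add)
    qed simp
    then show ?thesis using Suc by simp
  qed simp
  have "(\<Prod>j\<in>J. b j ^ (k j - 1)) dvd D (\<Prod>j\<in>J. b j ^ k j)"
    using assms(1)
  proof (induction J)
    case (insert j J)
    have "b j ^ (k j - 1) * (\<Prod>j\<in>J. b j ^ (k j - 1))
        dvd D (b j ^ k j) * (\<Prod>j\<in>J. b j ^ k j) + b j ^ k j * D (\<Prod>j\<in>J. b j ^ k j)"
      by (intro dvd_add mult_dvd_mono D_power power prod_dvd_prod insert.IH)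
    then show ?case using insert.hyps by (simp add: D_mult)
  qed simp
  moreover obtain y where "x = (\<Prod>j\<in>J. b j ^ k j) * y" using assms(2) ..
  moreover have "(\<Prod>j\<in>J. b j ^ (k j - 1)) dvd (\<Prod>j\<in>J. b j ^ k j)"
    by (intro prod_dvd_prod power)
  ultimately show ?thesis by (auto simp: D_mult intro!: dvd_add)
qed

lemma prod_power_dvd_Dn:
  assumes "finite J" "(\<Prod>j\<in>J. b j ^ k j) dvd x"
  shows "(\<Prod>j\<in>J. b j ^ (k j - n)) dvd (D ^^ n) x"
proof (induction n)
  case (Suc n)
  then show ?case using prod_power_dvd_D[OF assms(1) Suc] by simp
qed (use assms in simp)

section \<open>Wronskians\<close>

definition wronskian_mat :: "'b list \<Rightarrow> 'b mat"
  where "wronskian_mat xs = mat (length xs) (length xs) (\<lambda>(l, i). (D ^^ l) (xs ! i))"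

definition wronskian :: "'b list \<Rightarrow> 'b"
  where "wronskian xs = det (wronskian_mat xs)"

lemma wronskian_mat_carrier [simp]: "wronskian_mat xs \<in> carrier_mat (length xs) (length xs)"
  by (simp add: wronskian_mat_def)

lemma wronskian_Nil [simp]: "wronskian [] = 1"
  by (simp add: wronskian_def wronskian_mat_def)

lemma wronskian_mat_mult_vec:
  "l < length xs \<Longrightarrow> v \<in> carrier_vec (length xs) \<Longrightarrow>
    (wronskian_mat xs *\<^sub>v v) $ l = (\<Sum>i<length xs. (D ^^ l) (xs ! i) * v $ i)"
  by (auto simp: wronskian_mat_def scalar_prod_def atLeast0LessThan intro!: sum.cong)

text \<open>This is the span of \<open>xs\<close> over the fraction field of the kernel of
  \<open>D\<close>, with denominators cleared: \<open>c\<close> is a common denominator.\<close>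

definition constant_span :: "'b list \<Rightarrow> 'b \<Rightarrow> bool"
  where "constant_span xs y \<longleftrightarrow> (\<exists>c u. c \<noteq> 0 \<and> D c = 0 \<and> (\<forall>i<length xs. D (u i) = 0) \<and>
    c * y = (\<Sum>i<length xs. u i * xs ! i))"

lemma constant_span_nth:
  assumes "i < length xs"
  shows "constant_span xs (xs ! i)"
  unfolding constant_span_def
  by (intro exI[of _ 1] exI[of _ "\<lambda>j. if j = i then 1 else 0"])
    (use assms in \<open>auto simp: if_distrib[of "\<lambda>t. t * _"] if_distrib[of D] sum.delta cong: if_cong\<close>)

lemma constant_span_0: "constant_span xs 0"
  unfolding constant_span_def by (intro exI[of _ 1] exI[of _ "\<lambda>_. 0"]) auto

lemma constant_span_add:
  assumes "constant_span xs y" "constant_span xs z"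
  shows "constant_span xs (y + z)"
proof -
  obtain c u d v where
    c: "c \<noteq> 0" "D c = 0" "\<forall>i<length xs. D (u i) = 0" "c * y = (\<Sum>i<length xs. u i * xs ! i)" and
    d: "d \<noteq> 0" "D d = 0" "\<forall>i<length xs. D (v i) = 0" "d * z = (\<Sum>i<length xs. v i * xs ! i)"
    using assms unfolding constant_span_def by blast
  have "(c * d) * (y + z) = d * (c * y) + c * (d * z)" by (simp add: algebra_simps)
  also have "\<dots> = (\<Sum>i<length xs. (d * u i + c * v i) * xs ! i)"
    unfolding c(4) d(4) by (simp add: sum_distrib_left sum.distrib algebra_simps)
  finally show ?thesis
    unfolding constant_span_def
    by (intro exI[of _ "c * d"] exI[of _ "\<lambda>i. d * u i + c * v i"])
      (use c d in \<open>auto simp: D_add D_mult\<close>)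
qed

lemma constant_span_uminus:
  assumes "constant_span xs y"
  shows "constant_span xs (- y)"
proof -
  obtain c u where
    "c \<noteq> 0" "D c = 0" "\<forall>i<length xs. D (u i) = 0" "c * y = (\<Sum>i<length xs. u i * xs ! i)"
    using assms unfolding constant_span_def by blast
  then show ?thesis
    unfolding constant_span_def
    by (intro exI[of _ c] exI[of _ "\<lambda>i. - u i"]) (auto simp: D_uminus sum_negf)
qed

lemma constant_span_sum:
  "(\<And>i. i \<in> A \<Longrightarrow> constant_span xs (g i)) \<Longrightarrow> constant_span xs (sum g A)"
  by (induction A rule: infinite_finite_induct) (auto intro: constant_span_0 constant_span_add)

text \<open>
  A kernel vector \<open>v\<close> of the larger Wronskian matrix has last entry \<open>p \<noteq> 0\<close>, and differentiating
  the relations shows that all \<open>v\<^sub>i / p\<close> are constants of the fraction field. Hence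
  \<open>v\<^sub>i / p = D\<^sup>n v\<^sub>i / D\<^sup>n p\<close>, and for \<open>n = deg p\<close> this is a quotient of constants of \<open>D\<close>.
\<close>
lemma constant_span_if_wronskian_snoc_eq_0:
  assumes nz: "wronskian xs \<noteq> 0" and z: "wronskian (xs @ [y]) = 0"
  shows "constant_span xs y"
proof -
  define s where "s = length xs"
  obtain v where v: "v \<in> carrier_vec (Suc s)" "v \<noteq> 0\<^sub>v (Suc s)"
    "wronskian_mat (xs @ [y]) *\<^sub>v v = 0\<^sub>v (Suc s)"
    using z det_0_iff_vec_prod_zero[OF wronskian_mat_carrier[of "xs @ [y]"]]
    by (auto simp: wronskian_def s_def)
  define p where "p = v $ s"
  have rel: "(\<Sum>i<s. (D ^^ l) (xs ! i) * v $ i) + (D ^^ l) y * p = 0" if "l \<le> s" for l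
  proof -
    have "0 = (wronskian_mat (xs @ [y]) *\<^sub>v v) $ l" using v(3) that by simp
    also have "\<dots> = (\<Sum>i<Suc s. (D ^^ l) ((xs @ [y]) ! i) * v $ i)"
      using that v(1) by (subst wronskian_mat_mult_vec) (auto simp: s_def)
    finally show ?thesis by (simp add: s_def p_def nth_append)
  qed
  \<comment> \<open>The nonvanishing Wronskian makes the matrix of \<open>xs\<close> injective. This
    is applied to the entries of \<open>v\<close> and to the numerators of the derivatives of
    \<open>v $ i / p\<close>.\<close>
  have inj: "w i = 0"
    if w: "\<And>l. l < s \<Longrightarrow> (\<Sum>i<s. (D ^^ l) (xs ! i) * w i) = 0" and i: "i < s" for w i
  proof (rule ccontr)
    assume "w i \<noteq> 0"
    then have "vec s w \<noteq> 0\<^sub>v s" using i by (metis index_vec index_zero_vec(1))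
    moreover have "wronskian_mat xs *\<^sub>v vec s w = 0\<^sub>v s"
    proof (rule eq_vecI)
      fix l assume "l < dim_vec (0\<^sub>v s :: 'b vec)"
      then have "l < s" by simp
      then show "(wronskian_mat xs *\<^sub>v vec s w) $ l = 0\<^sub>v s $ l"
        using w[of l] by (subst wronskian_mat_mult_vec) (auto simp: s_def)
    qed (simp add: wronskian_mat_def s_def)
    ultimately have "wronskian xs = 0"
      unfolding wronskian_def using det_0_iff_vec_prod_zero[OF wronskian_mat_carrier[of xs]]
      by (metis s_def vec_carrier)
    with nz show False by simp
  qed
  have "p \<noteq> 0"
  proof
    assume "p = 0"
    then have "v $ i = 0" if "i < s" for i
      using inj[of "\<lambda>i. v $ i" i] rel that by simp
    then have "v = 0\<^sub>v (Suc s)"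
      using v(1) \<open>p = 0\<close> by (intro eq_vecI) (auto simp: p_def less_Suc_eq)
    with v(2) show False ..
  qed
  have ratio: "p * D (v $ i) = D p * v $ i" if "i < s" for i
  proof -
    \<comment> \<open>Differentiate relation \<open>l\<close> and subtract relation
      \<open>l + 1\<close>, available since \<open>l < s\<close>; \<open>p\<close> times the result
      minus \<open>D p\<close> times relation \<open>l\<close> eliminates \<open>y\<close>.\<close>
    have "(\<Sum>i<s. (D ^^ l) (xs ! i) * (p * D (v $ i) - D p * v $ i)) = 0" if l: "l < s" for l
    proof -
      let ?S = "\<Sum>i<s. (D ^^ l) (xs ! i) * v $ i"
      let ?S' = "\<Sum>i<s. (D ^^ Suc l) (xs ! i) * v $ i"
      let ?T = "\<Sum>i<s. (D ^^ l) (xs ! i) * D (v $ i)"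
      have "D (?S + (D ^^ l) y * p) = 0" using rel[of l] l by simp
      then have "?S' + ?T + (D ^^ Suc l) y * p + (D ^^ l) y * D p = 0"
        by (simp add: D_add D_sum D_mult sum.distrib algebra_simps)
      moreover have "?S' + (D ^^ Suc l) y * p = 0" using rel[of "Suc l"] l by simp
      moreover have "t + d = 0" if "a + t + c + d = 0" "a + c = 0" for a t c d :: 'b
      proof -
        have "t + d = (a + t + c + d) - (a + c)" by (simp add: algebra_simps)
        then show ?thesis using that by simp
      qed
      ultimately have "?T + (D ^^ l) y * D p = 0" by blast
      moreover have "?S + (D ^^ l) y * p = 0" using rel l by simp
      moreover have "a * t - a' * t' = 0" if "t + z * a' = 0" "t' + z * a = 0" for a a' t t' z :: 'b
      proof -
        have "a * t - a' * t' = a * (t + z * a') - a' * (t' + z * a)" by (simp add: algebra_simps)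
        then show ?thesis using that by simp
      qed
      ultimately have "p * ?T - D p * ?S = 0" by blast
      then show ?thesis by (simp add: algebra_simps sum_distrib_left sum_subtractf)
    qed
    from inj[OF this that] show ?thesis by simp
  qed
  have Dn_ratio: "p * (D ^^ n) (v $ i) = (D ^^ n) p * v $ i" if "i < s" for n i
  proof (induction n)
    case (Suc n)
    let ?w = "v $ i"
    have "D p * (D ^^ n) ?w + p * (D ^^ Suc n) ?w = (D ^^ Suc n) p * ?w + (D ^^ n) p * D ?w"
      using arg_cong[OF Suc, of D] by (simp add: D_mult)
    \<comment> \<open>The extra factor \<open>p\<close> lets the induction hypothesis and
      \<open>ratio\<close> identify the two cross terms; it is cancelled at the end.\<close>
    moreover have "p * (D p * (D ^^ n) ?w) = p * ((D ^^ n) p * D ?w)"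
      using Suc ratio[OF that] by (metis mult.left_commute)
    ultimately have "p * (p * (D ^^ Suc n) ?w) = p * ((D ^^ Suc n) p * ?w)"
      by (metis add.commute add_left_cancel distrib_left)
    then show ?case using \<open>p \<noteq> 0\<close> by simp
  qed simp
  define c where "c = (D ^^ deg p) p"
  \<comment> \<open>The sign comes from moving the sum in relation \<open>0\<close> to the other
    side.\<close>
  define u where "u i = - (D ^^ deg p) (v $ i)" for i
  have "c \<noteq> 0" using \<open>p \<noteq> 0\<close> by (simp add: c_def Dn_deg_nonzero)
  moreover have "D c = 0" using Dn_Suc_deg[of p] by (simp add: c_def)
  moreover have "D (u i) = 0" if "i < s" for i
    using Dn_ratio[OF that, of "Suc (deg p)"] \<open>p \<noteq> 0\<close> Dn_Suc_deg[of p]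
    by (simp add: u_def D_uminus)
  moreover have "c * y = (\<Sum>i<s. u i * xs ! i)"
  proof -
    have "0 = c * ((\<Sum>i<s. xs ! i * v $ i) + y * p)" using rel[of 0] by simp
    also have "\<dots> = (\<Sum>i<s. xs ! i * (c * v $ i)) + p * (c * y)"
      by (simp add: algebra_simps sum_distrib_left)
    also have "(\<Sum>i<s. xs ! i * (c * v $ i)) = (\<Sum>i<s. xs ! i * (p * (- u i)))"
      by (intro sum.cong) (use Dn_ratio in \<open>auto simp: c_def u_def\<close>)
    also have "\<dots> = p * (\<Sum>i<s. - (u i * xs ! i))"
      by (simp add: algebra_simps sum_distrib_left)
    finally have "p * ((\<Sum>i<s. - (u i * xs ! i)) + c * y) = 0" by (simp add: algebra_simps)
    then show ?thesis using \<open>p \<noteq> 0\<close> by (simp add: sum_negf)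
  qed
  ultimately show ?thesis unfolding constant_span_def s_def by blast
qed

text \<open>In a nonzero term of the permutation expansion, row \<open>l\<close> contributes a
  factor differentiated \<open>l\<close> times, at a cost of exactly \<open>l\<close> degrees; the
  permutation only reorders the degrees of the entries.\<close>

lemma deg_wronskian:
  assumes "wronskian xs \<noteq> 0"
  shows "deg (wronskian xs) + (\<Sum>l<length xs. l) \<le> (\<Sum>x\<leftarrow>xs. deg x)"
proof -
  define s where "s = length xs"
  define N where "N = (\<Sum>i<s. deg (xs ! i))"
  define T where "T q = (\<Prod>l<s. (D ^^ l) (xs ! q l))" for q
  have wr: "wronskian xs = (\<Sum>q | q permutes {..<s}. signof q * T q)"
    unfolding wronskian_def T_def
    by (subst det_def'[OF wronskian_mat_carrier])
      (auto simp: wronskian_mat_def s_def atLeast0LessThan permutes_in_image intro!: sum.cong prod.cong)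
  have T: "deg (T q) + (\<Sum>l<s. l) = N" if "q permutes {..<s}" "T q \<noteq> 0" for q
  proof -
    have nz: "(D ^^ l) (xs ! q l) \<noteq> 0" if "l < s" for l
      using \<open>T q \<noteq> 0\<close> that by (auto simp: T_def)
    have "deg (T q) = (\<Sum>l<s. deg ((D ^^ l) (xs ! q l)))"
      unfolding T_def by (rule deg_prod) (use nz in auto)
    then have "deg (T q) + (\<Sum>l<s. l) = (\<Sum>l<s. deg (xs ! q l))"
      using deg_Dn[OF nz] by (simp flip: sum.distrib)
    also have "\<dots> = N"
      unfolding N_def using sum.permute[OF that(1), of "\<lambda>l. deg (xs ! l)"] by simp
    finally show ?thesis .
  qed
  \<comment> \<open>A nonzero term forces \<open>(\<Sum>l<s. l) \<le> N\<close>, so the subtraction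
    below is not truncated.\<close>
  have "\<exists>q. q permutes {..<s} \<and> T q \<noteq> 0"
    using assms unfolding wr by (metis (mono_tags, lifting) mem_Collect_eq mult_zero_right sum.neutral)
  then have le: "(\<Sum>l<s. l) \<le> N" using T by (metis le_add2)
  have "deg (wronskian xs) \<le> N - (\<Sum>l<s. l)"
  proof -
    have "(D ^^ Suc (N - (\<Sum>l<s. l))) (signof q * T q) = 0" if "q permutes {..<s}" for q
    proof (cases "T q = 0")
      case False
      then have "deg (T q) \<le> N - (\<Sum>l<s. l)" using T[OF that] by linarith
      moreover have "D (signof q) = 0" by (simp add: sign_def D_uminus)
      ultimately show ?thesis unfolding deg_le_iff by (simp add: Dn_mult_const del: funpow.simps)
    qed (simp del: funpow.simps)
    then show ?thesis
      unfolding deg_le_iff wr by (simp add: Dn_sum del: funpow.simps)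
  qed
  moreover have "N = (\<Sum>x\<leftarrow>xs. deg x)"
    by (simp add: N_def s_def sum_list_sum_nth atLeast0LessThan)
  ultimately show ?thesis using le by (simp add: s_def)
qed

lemma dvd_det_column:
  fixes A :: "'b mat"
  assumes "A \<in> carrier_mat n n" "j < n" "\<And>i. i < n \<Longrightarrow> p dvd A $$ (i, j)"
  shows "p dvd det A"
  unfolding laplace_expansion_column[OF assms(1,2)] using assms(3) by (auto intro!: dvd_sum)

section \<open>A Mason-type inequality\<close>

text \<open>The index \<open>i0\<close> is arbitrary here and is chosen of maximal degree only
  later. The number \<open>s\<close> is the highest order of derivative in the maximal Wronskian,
  and \<open>e i\<close> takes up the scalar factors.\<close>

lemma mason_inequality:
  fixes f :: "'i \<Rightarrow> 'b" and J :: "'i \<Rightarrow> 'j set"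
  assumes fin: "finite I" "\<And>i. i \<in> I \<Longrightarrow> finite (J i)"
    and i0: "i0 \<in> I"
    and nz: "\<And>i. i \<in> I \<Longrightarrow> f i \<noteq> 0"
    and sum0: "sum f I = 0"
    and rp: "\<And>i j. i \<in> I \<Longrightarrow> j \<in> I \<Longrightarrow> i \<noteq> j \<Longrightarrow> relatively_prime (f i) (f j)"
    and f: "\<And>i. i \<in> I \<Longrightarrow> f i = e i * (\<Prod>j\<in>J i. b i j ^ k i j)"
    and e: "\<And>i. i \<in> I \<Longrightarrow> D (e i) = 0"
    and k: "\<And>i j. i \<in> I \<Longrightarrow> j \<in> J i \<Longrightarrow> k i j > 0"
  shows "\<exists>S\<subseteq>I. \<exists>s. i0 \<in> S \<and> card S = s + 2 \<and>
    deg (f i0) + (\<Sum>l\<le>s. l) \<le> s * (\<Sum>i\<in>S. \<Sum>j\<in>J i. deg (b i j))"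
proof -
  define P where "P xs \<longleftrightarrow> distinct xs \<and> set xs \<subseteq> I - {i0} \<and> wronskian (map f xs) \<noteq> 0" for xs
  have "length xs < Suc (card I)" if "P xs" for xs
  proof -
    have "distinct xs" "set xs \<subseteq> I" using that by (auto simp: P_def)
    then show ?thesis using distinct_card[of xs] card_mono[OF fin(1), of "set xs"] by simp
  qed
  \<comment> \<open>The empty Wronskian is \<open>1\<close>, so there is a list to start
    from.\<close>
  moreover have "P []" by (simp add: P_def)
  ultimately obtain xs where xs: "P xs" and max: "\<And>ys. P ys \<Longrightarrow> length ys \<le> length xs"
    using Lattices_Big.ex_has_greatest_nat[of P "[]" length "Suc (card I)"] by auto
  have span: "constant_span (map f xs) (f i)" if i: "i \<in> I - {i0}" for i
  proof (cases "i \<in> set xs")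
    case True
    then show ?thesis using constant_span_nth[of _ "map f xs"] by (auto simp: in_set_conv_nth)
  next
    case False
    then have "wronskian (map f xs @ [f i]) = 0"
      using max[of "xs @ [i]"] xs i by (auto simp: P_def)
    then show ?thesis using xs constant_span_if_wronskian_snoc_eq_0 by (auto simp: P_def)
  qed
  have "f i0 = - sum f (I - {i0})"
    using sum0 fin(1) i0 by (simp add: sum.remove[of I i0] eq_neg_iff_add_eq_0)
  then have "constant_span (map f xs) (f i0)"
    using constant_span_uminus[OF constant_span_sum[of "I - {i0}"]] span by simp
  then obtain c u where c: "c \<noteq> 0" "D c = 0" and u: "\<And>i. i < length xs \<Longrightarrow> D (u i) = 0"
    and cu: "c * f i0 = (\<Sum>i<length xs. u i * f (xs ! i))"
    unfolding constant_span_def by auto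
  \<comment> \<open>A nonzero coefficient serves twice: it shows that \<open>xs\<close> is nonempty,
    so that \<open>s\<close> exists, and it is the factor that Cramer's rule puts in front of
    \<open>W\<close>.\<close>
  have "\<exists>t<length xs. u t \<noteq> 0"
  proof (rule ccontr)
    assume "\<not> ?thesis"
    then have "c * f i0 = 0" unfolding cu by auto
    then show False using c nz[OF i0] by simp
  qed
  then obtain t where t: "t < length xs" "u t \<noteq> 0" by blast
  obtain s where s: "length xs = Suc s" using t(1) by (cases xs) auto
  have i0_notin: "i0 \<notin> set xs" using xs by (auto simp: P_def)
  define S where "S = insert i0 (set xs)"
  have S: "S \<subseteq> I" "card S = s + 2" "finite S"
    using xs i0 s distinct_card[of xs] by (auto simp: S_def P_def card_insert_if)
  define W where "W = wronskian (map f xs)"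
  have W: "W \<noteq> 0" using xs by (simp add: W_def P_def)
  \<comment> \<open>No derivative of order above \<open>s\<close> occurs in the matrix, so lowering
    the exponents by \<open>s\<close> gives a divisor of a whole column.\<close>
  define p where "p i = (\<Prod>j\<in>J i. b i j ^ (k i j - s))" for i
  have b: "b i j \<noteq> 0" if "i \<in> I" "j \<in> J i" for i j
    using nz[OF that(1)] f[OF that(1)] k[OF that] that fin(2) by auto
  have p_Dn: "p i dvd (D ^^ l) (f i)" if "i \<in> I" "l \<le> s" for i l
  proof -
    have "p i dvd (\<Prod>j\<in>J i. b i j ^ (k i j - l))"
      unfolding p_def using that(2) by (intro prod_dvd_prod le_imp_power_dvd) auto
    also have "\<dots> dvd (D ^^ l) (f i)"
      using that fin(2) f by (intro prod_power_dvd_Dn) auto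
    finally show ?thesis .
  qed
  have p_W: "p i dvd u t * W" if "i \<in> S" for i
  proof (cases "i = i0")
    case False
    then obtain q where q: "q < length xs" "i = xs ! q"
      using \<open>i \<in> S\<close> by (auto simp: S_def in_set_conv_nth)
    have "p i dvd det (wronskian_mat (map f xs))"
    proof (rule dvd_det_column)
      show "wronskian_mat (map f xs) \<in> carrier_mat (length xs) (length xs)"
        by (simp add: wronskian_mat_def)
      show "p i dvd wronskian_mat (map f xs) $$ (l, q)" if "l < length xs" for l
        using p_Dn[of i l] q that S \<open>i \<in> S\<close> s by (auto simp: wronskian_mat_def)
    qed (use q in simp)
    then show ?thesis by (simp add: W_def wronskian_def)
  next
    case True
    \<comment> \<open>\<open>f i0\<close> gives no column of the matrix. Applying the matrix to the
      coefficients \<open>u\<close> yields \<open>c\<close> times its derivatives, and putting this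
      vector in column \<open>t\<close> multiplies the determinant by \<open>u t\<close>.\<close>
    let ?A = "wronskian_mat (map f xs)"
    let ?w = "vec (length xs) u"
    have A: "?A \<in> carrier_mat (length xs) (length xs)" by (simp add: wronskian_mat_def)
    have Aw: "(?A *\<^sub>v ?w) $ l = c * (D ^^ l) (f i0)" if "l < length xs" for l
    proof -
      have "(?A *\<^sub>v ?w) $ l = (\<Sum>i<length xs. (D ^^ l) (u i * f (xs ! i)))"
        using that by (subst wronskian_mat_mult_vec) (auto simp: Dn_mult_const u mult.commute)
      also have "\<dots> = (D ^^ l) (c * f i0)" by (simp add: cu Dn_sum)
      finally show ?thesis using c by (simp add: Dn_mult_const)
    qed
    have "p i dvd det (replace_col ?A (?A *\<^sub>v ?w) t)"
    proof (rule dvd_det_column)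
      show "replace_col ?A (?A *\<^sub>v ?w) t \<in> carrier_mat (length xs) (length xs)"
        using A by (simp add: replace_col_def)
      show "p i dvd replace_col ?A (?A *\<^sub>v ?w) t $$ (l, t)" if "l < length xs" for l
        using p_Dn[of i0 l] i0 that s Aw[OF that] A t True by (auto simp: replace_col_def)
    qed (use t in simp)
    also have "\<dots> = u t * W"
      using cramer_lemma_mat[OF A, of ?w t] t(1) by (simp add: W_def wronskian_def)
    finally show ?thesis .
  qed
  have p_nz: "p i \<noteq> 0" if "i \<in> I" for i
    using b that fin(2) by (auto simp: p_def)
  have "prod p S dvd u t * W"
  proof (rule prod_dvd_if_pairwise_relatively_prime)
    fix i j assume "i \<in> S" "j \<in> S" "i \<noteq> j"
    then have ij: "i \<in> I" "j \<in> I" using S by auto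
    show "relatively_prime (p i) (p j)"
    proof (rule relatively_prime_dvd)
      show "relatively_prime (f i) (f j)" using rp ij \<open>i \<noteq> j\<close> by blast
      show "p i dvd f i" "p j dvd f j" using p_Dn[of _ 0] ij by simp_all
    qed (use nz ij in simp_all)
  qed (use S p_nz p_W in auto)
  then have "deg (prod p S) \<le> deg (u t * W)" using t W by (intro deg_dvd) auto
  also have "\<dots> = deg W" using t W u[of t] by (simp add: deg_mult deg_eq_0_iff)
  finally have "deg (prod p S) + (\<Sum>l\<le>s. l) \<le> (\<Sum>x\<leftarrow>xs. deg (f x))"
    using deg_wronskian[of "map f xs"] W s by (simp add: W_def lessThan_Suc_atMost comp_def)
  also have "(\<Sum>x\<leftarrow>xs. deg (f x)) = (\<Sum>i\<in>set xs. deg (f i))"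
    using xs by (simp add: P_def sum_list_distinct_conv_sum_set)
  \<comment> \<open>Adding \<open>deg (f i0)\<close> to both sides completes the sum over
    \<open>xs\<close> to one over \<open>S\<close>, from which the degrees of the \<open>p i\<close>
    then cancel.\<close>
  finally have "deg (prod p S) + (\<Sum>l\<le>s. l) + deg (f i0) \<le> (\<Sum>i\<in>S. deg (f i))"
    using i0_notin by (simp add: S_def)
  also have "\<dots> \<le> (\<Sum>i\<in>S. deg (p i) + s * (\<Sum>j\<in>J i. deg (b i j)))"
  proof (rule sum_mono)
    fix i assume "i \<in> S"
    then have i: "i \<in> I" using S by auto
    have "deg (f i) = (\<Sum>j\<in>J i. k i j * deg (b i j))"
      using nz[OF i] f[OF i] e[OF i] b[OF i] by (simp add: deg_mult deg_prod deg_power deg_eq_0_iff)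
    \<comment> \<open>Only an inequality, because the subtraction is truncated when
      \<open>k i j < s\<close>.\<close>
    also have "\<dots> \<le> (\<Sum>j\<in>J i. (k i j - s) * deg (b i j) + s * deg (b i j))"
      by (intro sum_mono) (auto simp flip: distrib_right intro!: mult_le_mono1)
    also have "\<dots> = deg (p i) + s * (\<Sum>j\<in>J i. deg (b i j))"
      using b[OF i] by (simp add: p_def deg_prod deg_power sum.distrib sum_distrib_left)
    finally show "deg (f i) \<le> deg (p i) + s * (\<Sum>j\<in>J i. deg (b i j))" .
  qed
  also have "\<dots> = deg (prod p S) + s * (\<Sum>i\<in>S. \<Sum>j\<in>J i. deg (b i j))"
    using p_nz S by (subst deg_prod) (auto simp: sum.distrib sum_distrib_left)
  finally show ?thesis using S by (intro exI[of _ S]) (auto simp: S_def)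
qed

end

section \<open>From the degree inequality to the Makar-Limanov invariant\<close>

theorem corollary4p11:
  fixes scale :: "'k::{alg_closed_field, field_char_0} \<Rightarrow> 'b::idom \<Rightarrow> 'b"
    and m :: nat
    and n :: "nat \<Rightarrow> nat"
    and a :: "nat \<Rightarrow> 'k"
    and k :: "nat \<Rightarrow> nat \<Rightarrow> nat"
    and b :: "nat \<Rightarrow> nat \<Rightarrow> 'b"
    and f :: "nat \<Rightarrow> 'b"
  assumes B: "comm_algebra scale"
    and m: "m \<ge> 3"
    and n: "\<And>i. i \<in> {1..m} \<Longrightarrow> n i > 0"
    and a: "\<And>i. i \<in> {1..m} \<Longrightarrow> a i \<noteq> 0"
    and k: "\<And>i j. i \<in> {1..m} \<Longrightarrow> j \<in> {1..n i} \<Longrightarrow> k i j > 0"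
    and f: "\<And>i. i \<in> {1..m} \<Longrightarrow> f i = scale (a i) (\<Prod>j=1..n i. b i j ^ k i j)"
    and f_nonzero: "\<And>i. i \<in> {1..m} \<Longrightarrow> f i \<noteq> 0"
    and f_sum: "(\<Sum>i=1..m. f i) = 0"
    and f_prime: "\<And>i i'. i \<in> {1..m} \<Longrightarrow> i' \<in> {1..m} \<Longrightarrow> i \<noteq> i' \<Longrightarrow>
                    relatively_prime (f i) (f i')"
    and k_sum: "(\<Sum>i=1..m. \<Sum>j=1..n i. 1 / real (k i j)) \<le> 1 / (real m - 2)"
  shows "comm_algebra.generated_subalgebra scale {b i j | i j. i \<in> {1..m} \<and> j \<in> {1..n i}}
           \<subseteq> comm_algebra.makar_limanov scale"
proof -
  interpret comm_algebra scale by (rule B)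
  have b_const: "D (b i j) = 0" if D: "D \<in> LND" and ij: "i \<in> {1..m}" "j \<in> {1..n i}" for D i j
  proof -
    have lin: "Vector_Spaces.linear scale scale D"
      using D by (simp add: LND_def derivation_def)
    \<comment> \<open>This turns \<open>a i\<close> into the ring element
      \<open>scale (a i) 1\<close>, a constant of \<open>D\<close> that serves as
      \<open>e i\<close>.\<close>
    have scale_1: "scale c x = scale c 1 * x" for c x
      by (simp add: mult_scale_left)
    interpret lin: Vector_Spaces.linear scale scale D by (rule lin)
    interpret locally_nilpotent_derivation D
    proof
      show "D (x + y) = D x + D y" for x y by (rule lin.add)
      show "D (x * y) = D x * y + x * D y" for x y
        using D by (simp add: LND_def derivation_def)
      show "\<exists>n. (D ^^ n) x = 0" for x
        using D by (simp add: LND_def locally_nilpotent_def)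
      show "of_nat n \<noteq> (0::'b)" if "n > 0" for n
      proof -
        have "of_nat n = scale (of_nat n) (1::'b)"
          by (induction n) (auto simp: scale_left_distrib)
        then show ?thesis using that by simp
      qed
    qed
    have D_scale_1: "D (scale c 1) = 0" for c
      by (simp add: lin.scale)
    define d where "d = Max ((\<lambda>i. deg (f i)) ` {1..m})"
    have "d \<in> (\<lambda>i. deg (f i)) ` {1..m}"
      unfolding d_def using m by (intro Max_in) auto
    then obtain i0 where i0: "i0 \<in> {1..m}" "d = deg (f i0)" by blast
    have d_max: "deg (f i) \<le> d" if "i \<in> {1..m}" for i
      unfolding d_def using that by (intro Max_ge) auto
    have f': "f i = scale (a i) 1 * (\<Prod>j\<in>{1..n i}. b i j ^ k i j)" if "i \<in> {1..m}" for i
      unfolding f[OF that] by (rule scale_1)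
    have k_deg: "k i j * deg (b i j) \<le> d" if ij: "i \<in> {1..m}" "j \<in> {1..n i}" for i j
    proof -
      have "b i j ^ k i j dvd (\<Prod>j\<in>{1..n i}. b i j ^ k i j)"
        using ij by (intro dvd_prodI) auto
      then have dvd: "b i j ^ k i j dvd f i"
        using f'[OF ij(1)] by simp
      \<comment> \<open>Since \<open>0\<close> is relatively prime to everything,
        \<open>f i = 0\<close> through one vanishing factor would leave the other factors
        unconstrained; \<open>f_nonzero\<close> excludes this.\<close>
      moreover have "b i j \<noteq> 0"
        using dvd f_nonzero[OF ij(1)] k[OF ij] by auto
      ultimately show ?thesis
        using deg_dvd[OF dvd f_nonzero[OF ij(1)]] d_max[OF ij(1)] by (simp add: deg_power)
    qed
    have "d = 0"
    proof (rule ccontr)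
      assume "d \<noteq> 0"
      obtain S s where S: "S \<subseteq> {1..m}" "card S = s + 2"
        "d + (\<Sum>l\<le>s. l) \<le> s * (\<Sum>i\<in>S. \<Sum>j\<in>{1..n i}. deg (b i j))"
        using mason_inequality[of "{1..m}" "\<lambda>i. {1..n i}" i0 f "\<lambda>i. scale (a i) 1" b k]
          i0(1) f_nonzero f_sum f_prime f' D_scale_1 k
        unfolding i0(2) by auto
      \<comment> \<open>For \<open>s = 0\<close> the inequality reads
        \<open>d \<le> 0\<close>.\<close>
      have "s > 0" using S(3) \<open>d \<noteq> 0\<close> by (cases s) auto
      have "s \<le> m - 2" using card_mono[OF _ S(1)] S(2) by simp
      then have s_m: "real s \<le> real m - 2" using m by linarith
      \<comment> \<open>This surplus makes the final estimate strict, as it must be because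
        \<open>k_sum\<close> allows equality.\<close>
      have "s \<le> (\<Sum>l\<le>s. l)" by (rule member_le_sum) auto
      with S(3) have "d + s \<le> s * (\<Sum>i\<in>S. \<Sum>j\<in>{1..n i}. deg (b i j))" by linarith
      then have "real (d + s) \<le> real (s * (\<Sum>i\<in>S. \<Sum>j\<in>{1..n i}. deg (b i j)))"
        by (rule of_nat_mono)
      also have "\<dots> = real s * (\<Sum>i\<in>S. \<Sum>j\<in>{1..n i}. real (deg (b i j)))" by simp
      also have "\<dots> \<le> real s * (\<Sum>i\<in>S. \<Sum>j\<in>{1..n i}. real d * (1 / real (k i j)))"
      proof (intro mult_left_mono sum_mono)
        fix i j assume ij: "i \<in> S" "j \<in> {1..n i}"
        then have "real (k i j) * real (deg (b i j)) \<le> real d"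
          using k_deg[of i j] S(1) by (metis of_nat_le_iff of_nat_mult subsetD)
        moreover have "real (k i j) > 0" using k[of i j] ij S(1) by auto
        ultimately show "real (deg (b i j)) \<le> real d * (1 / real (k i j))"
          by (simp add: field_simps)
      qed simp
      also have "\<dots> \<le> real s * (\<Sum>i=1..m. \<Sum>j=1..n i. real d * (1 / real (k i j)))"
        using S(1) by (intro mult_left_mono sum_mono2 sum_nonneg) auto
      also have "\<dots> = real s * real d * (\<Sum>i=1..m. \<Sum>j=1..n i. 1 / real (k i j))"
        by (simp add: sum_distrib_left)
      also have "\<dots> \<le> real s * real d * (1 / (real m - 2))"
        by (intro mult_left_mono k_sum) simp
      also have "\<dots> \<le> (real m - 2) * real d * (1 / (real m - 2))"
        using s_m by (intro mult_right_mono) auto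
      also have "\<dots> = real d" using m by simp
      finally show False using \<open>s > 0\<close> by simp
    qed
    then have "deg (b i j) = 0" using k_deg[OF ij] k[OF ij] by simp
    then show ?thesis by (simp add: deg_eq_0_iff)
  qed
  \<comment> \<open>Kernels of derivations are subalgebras, hence so is their intersection, and it
    suffices that the generators are constants.\<close>
  have "subalgebra {x. D x = 0}" if "D \<in> LND" for D
  proof -
    have lin: "Vector_Spaces.linear scale scale D"
      and leibniz: "\<And>x y. D (x * y) = D x * y + x * D y"
      using that by (auto simp: LND_def derivation_def)
    interpret lin: Vector_Spaces.linear scale scale D by (rule lin)
    have "D 1 = 0"
      using leibniz[of 1 1] by (metis add_cancel_right_right mult_1 mult_1_right)
    then show ?thesis
      unfolding subalgebra_def subspace_def
      by (simp add: lin.zero lin.add lin.scale leibniz)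
  qed
  then have "subalgebra makar_limanov"
    by (auto simp: makar_limanov_def subalgebra_def subspace_def)
  then show ?thesis
    unfolding generated_subalgebra_def
    by (intro hull_minimal) (use b_const in \<open>auto simp: makar_limanov_def\<close>)
qed

end
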